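(* Let $p>3$ be a prime, $F$ a field of characteristic $p$, and $a\in F\setminus F^p$. Then the quasilinear $p$-forms $\varphi=\langle1,a\rangle$ and $\psi=\langle1,a^2\rangle$ over $F$ are Vishik equivalent but not similar.
   Context: A quasilinear $p$-form ($p$-form) over a field $F$ of characteristic $p>0$ is a map $\varphi:V\to F$ on a finite-dimensional $F$-vector space $V$ with $\varphi(av)=a^p\varphi(v)$ and $\varphi(v+w)=\varphi(v)+\varphi(w)$; $\dim\varphi=\dim V$. $\langle a_1,\dots,a_n\rangle$ denotes $(x_i)\mapsto\sum a_ix_i^p$ on $F^n$. Isometry $\varphi\simeq\psi$: there is a bijective linear $f$ with $\varphi(v)=\psi(f(v))$. Similar: $\varphi\simeq c\psi$ for some $c\in F^*$. A form is anisotropic if it vanishes only at $0$. Every $p$-form decomposes as $\varphi\simeq\varphi_{\mathrm{an}}\perp k\times\langle0\rangle$ with $\varphi_{\mathrm{an}}$ anisotropic; the defect is $\mathfrak{i}_{\mathrm d}(\varphi)=k$. For $E/F$, $\varphi_E$ on $E\otimes_FV$ is given by $\varphi_E(e\otimes v)=e^p\varphi(v)$. Vishik equivalence: $\dim\varphi=\dim\psi$ and $\mathfrak{i}_{\mathrm d}(\varphi_E)=\mathfrak{i}_{\mathrm d}(\psi_E)$ for every field extension $E/F$. *)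

theory Defs
  imports "HOL-Algebra.AbelCoset" "Jordan_Normal_Form.VS_Connect" "HOL-Library.Poly_Mapping"
begin

text \<open>
  A field is a type of class field; the associated ring record is \<open>class_ring\<close>, and vector spaces
  are module records over it, so that the vector space notions (\<open>vectorspace\<close>, \<open>fin_dim\<close>, \<open>dim\<close>,
  \<open>span\<close>, \<open>module_hom\<close>, \<open>direct_sum\<close>) are those of the library.
\<close>

section \<open>Quasilinear p-forms\<close>

record ('f, 'v) form =
  space :: "('f, 'v) module"
  val :: "'v \<Rightarrow> 'f"

definition p_form :: "nat \<Rightarrow> ('f::field, 'v) form \<Rightarrow> bool" where
  "p_form p \<phi> \<longleftrightarrow>
     0 < p \<and> CHAR('f) = p \<and>
     vectorspace class_ring (space \<phi>) \<and> vectorspace.fin_dim class_ring (space \<phi>) \<and>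
     (\<forall>a. \<forall>v\<in>carrier (space \<phi>). val \<phi> (a \<odot>\<^bsub>space \<phi>\<^esub> v) = a ^ p * val \<phi> v) \<and>
     (\<forall>v\<in>carrier (space \<phi>). \<forall>w\<in>carrier (space \<phi>).
        val \<phi> (v \<oplus>\<^bsub>space \<phi>\<^esub> w) = val \<phi> v + val \<phi> w)"

definition form_dim :: "('f::field, 'v) form \<Rightarrow> nat" where
  "form_dim \<phi> = vectorspace.dim class_ring (space \<phi>)"

definition diag_form :: "nat \<Rightarrow> 'f::field list \<Rightarrow> ('f, 'f vec) form" where
  "diag_form p as =
     \<lparr>space = module_vec TYPE('f) (length as), val = (\<lambda>x. \<Sum>i<length as. as ! i * (x $ i) ^ p)\<rparr>"

lemma p_form_diag_form:
  assumes "0 < p" and p: "CHAR('f::field) = p"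
  shows "p_form p (diag_form p (as :: 'f list))"
proof -
  interpret vec_space "TYPE('f)" "length as" .
  have prime: "prime CHAR('f)" using assms by (intro prime_CHAR_semidom) simp
  have pow_add: "(x + y) ^ p = x ^ p + y ^ p" for x y :: 'f
    using freshmans_dream[OF prime refl, of x y] by (simp add: p)
  show ?thesis
    unfolding p_form_def diag_form_def
    using assms fin_dim vectorspace_axioms
    by (auto simp: module_vec_simps power_mult_distrib pow_add sum_distrib_left sum.distrib
        distrib_left mult_ac)
qed

definition isometric :: "('f::field, 'v) form \<Rightarrow> ('f, 'w) form \<Rightarrow> bool" where
  "isometric \<phi> \<psi> \<longleftrightarrow>
     (\<exists>f\<in>LinearCombinations.module_hom class_ring (space \<phi>) (space \<psi>).
        bij_betw f (carrier (space \<phi>)) (carrier (space \<psi>)) \<and>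
        (\<forall>v\<in>carrier (space \<phi>). val \<phi> v = val \<psi> (f v)))"

definition scale_form :: "'f::field \<Rightarrow> ('f, 'v) form \<Rightarrow> ('f, 'v) form" where
  "scale_form c \<phi> = \<lparr>space = space \<phi>, val = (\<lambda>v. c * val \<phi> v)\<rparr>"

definition similar :: "('f::field, 'v) form \<Rightarrow> ('f, 'w) form \<Rightarrow> bool" where
  "similar \<phi> \<psi> \<longleftrightarrow> (\<exists>c. c \<noteq> 0 \<and> isometric \<phi> (scale_form c \<psi>))"

definition orth_sum :: "('f::field, 'v) form \<Rightarrow> ('f, 'w) form \<Rightarrow> ('f, 'v \<times> 'w) form" where
  "orth_sum \<phi> \<psi> =
     \<lparr>space = direct_sum (space \<phi>) (space \<psi>), val = (\<lambda>(v, w). val \<phi> v + val \<psi> w)\<rparr>"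

definition anisotropic :: "('f::field, 'v) form \<Rightarrow> bool" where
  "anisotropic \<phi> \<longleftrightarrow> (\<forall>v\<in>carrier (space \<phi>). val \<phi> v = 0 \<longrightarrow> v = \<zero>\<^bsub>space \<phi>\<^esub>)"

text \<open>
  The anisotropic part is isometric to the restriction of \<open>\<phi>\<close> to a subspace, so it is no loss of
  generality to look for it on the element type of the space of \<open>\<phi>\<close>.
\<close>

definition defect :: "nat \<Rightarrow> ('f::field, 'v) form \<Rightarrow> nat" where
  "defect p \<phi> =
     (THE k. \<exists>\<alpha> :: ('f, 'v) form. p_form p \<alpha> \<and> anisotropic \<alpha> \<and>
        isometric \<phi> (orth_sum \<alpha> (diag_form p (replicate k 0))))"


section \<open>Extension of scalars\<close>

definition quot_module :: "('a, 'b, 'm) module_scheme \<Rightarrow> 'b set \<Rightarrow> ('a, 'b set) module" where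
  "quot_module M N =
     \<lparr>carrier = a_rcosets\<^bsub>M\<^esub> N, mult = undefined, one = undefined, zero = N,
      add = (\<lambda>X Y. X <+>\<^bsub>M\<^esub> Y),
      smult = (\<lambda>a X. N <+>\<^bsub>M\<^esub> (\<lambda>x. a \<odot>\<^bsub>M\<^esub> x) ` X)\<rparr>"

text \<open>
  For a field homomorphism \<open>h : F \<rightarrow> E\<close>, the space \<open>E \<otimes>\<^sub>F V\<close> is the free \<open>E\<close>-vector space on the
  elements of \<open>V\<close> (\<open>Poly_Mapping.single v e\<close> standing for \<open>e[v]\<close>) modulo the subspace spanned by
  \<open>[v + w] - [v] - [w]\<close> and \<open>[a v] - h(a)[v]\<close>.
\<close>

definition free_vs :: "'v set \<Rightarrow> ('e::field, 'v \<Rightarrow>\<^sub>0 'e) module" where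
  "free_vs S =
     \<lparr>carrier = {c. Poly_Mapping.keys c \<subseteq> S}, mult = undefined, one = undefined, zero = 0, add = (+),
      smult = (\<lambda>a. Poly_Mapping.map ((*) a))\<rparr>"

definition tensor_relations ::
    "('f::field \<Rightarrow> 'e::field) \<Rightarrow> ('f, 'v) module \<Rightarrow> ('v \<Rightarrow>\<^sub>0 'e) set" where
  "tensor_relations h V =
     {Poly_Mapping.single (v \<oplus>\<^bsub>V\<^esub> w) 1 - Poly_Mapping.single v 1 - Poly_Mapping.single w 1 | v w.
        v \<in> carrier V \<and> w \<in> carrier V} \<union>
     {Poly_Mapping.single (a \<odot>\<^bsub>V\<^esub> v) 1 - Poly_Mapping.single v (h a) | a v. v \<in> carrier V}"

definition tensor_kernel ::
    "('f::field \<Rightarrow> 'e::field) \<Rightarrow> ('f, 'v) module \<Rightarrow> ('v \<Rightarrow>\<^sub>0 'e) set" where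
  "tensor_kernel h V =
     LinearCombinations.module.span class_ring (free_vs (carrier V)) (tensor_relations h V)"

definition tensor_vs ::
    "('f::field \<Rightarrow> 'e::field) \<Rightarrow> ('f, 'v) module \<Rightarrow> ('e, ('v \<Rightarrow>\<^sub>0 'e) set) module" where
  "tensor_vs h V = quot_module (free_vs (carrier V)) (tensor_kernel h V)"

definition pure_tensor ::
    "('f::field \<Rightarrow> 'e::field) \<Rightarrow> ('f, 'v) module \<Rightarrow> 'e \<Rightarrow> 'v \<Rightarrow> ('v \<Rightarrow>\<^sub>0 'e) set" where
  "pure_tensor h V e v = tensor_kernel h V +>\<^bsub>free_vs (carrier V)\<^esub> Poly_Mapping.single v e"

text \<open>
  On the class of a sum of the \<open>c(v)[v]\<close> the extended form takes the value given by the sum of the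
  \<open>c(v)\<^sup>p h(\<phi>(v))\<close>, for every representative \<open>c\<close>; see \<open>val_extend_form\<close> and
  \<open>val_extend_form_pure_tensor\<close> below.
\<close>

definition extend_form ::
    "nat \<Rightarrow> ('f::field \<Rightarrow> 'e::field) \<Rightarrow> ('f, 'v) form \<Rightarrow> ('e, ('v \<Rightarrow>\<^sub>0 'e) set) form" where
  "extend_form p h \<phi> =
     \<lparr>space = tensor_vs h (space \<phi>),
      val = (\<lambda>X. the_elem ((\<lambda>c. \<Sum>v\<in>Poly_Mapping.keys c. Poly_Mapping.lookup c v ^ p * h (val \<phi> v)) ` X))\<rparr>"

lemma lookup_smult: "Poly_Mapping.lookup (Poly_Mapping.map ((*) (a::'e::field)) c) v = a * Poly_Mapping.lookup c v"
  by (simp add: Poly_Mapping.map.rep_eq when_def)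

lemma keys_smult: "Poly_Mapping.keys (Poly_Mapping.map ((*) (a::'e::field)) c) \<subseteq> Poly_Mapping.keys c"
  by (auto simp: in_keys_iff lookup_smult)

lemma vectorspace_free_vs: "vectorspace class_ring (free_vs S :: ('e::field, 'v \<Rightarrow>\<^sub>0 'e) module)"
proof -
  let ?M = "free_vs S :: ('e, 'v \<Rightarrow>\<^sub>0 'e) module"
  have ag: "abelian_group ?M"
  proof (rule abelian_groupI)
    fix x assume "x \<in> carrier ?M"
    then show "\<exists>y\<in>carrier ?M. y \<oplus>\<^bsub>?M\<^esub> x = \<zero>\<^bsub>?M\<^esub>"
      by (intro bexI[of _ "-x"]) (auto simp: free_vs_def)
  qed (use Poly_Mapping.keys_add in \<open>fastforce simp: free_vs_def algebra_simps\<close>)+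
  have "module class_ring ?M"
    by (rule moduleI[OF class_cring.is_cring ag])
       (use keys_smult in \<open>fastforce simp: free_vs_def class_ring_simps intro!: poly_mapping_eqI simp: lookup_smult lookup_add algebra_simps\<close>)+
  then show ?thesis
    by (intro vectorspace.intro class_field.field_axioms)
qed

lemma vectorspace_quot_module:
  assumes "vectorspace class_ring (M :: ('e::field,'v) module)" and N: "LinearCombinations.submodule class_ring N M"
  shows "vectorspace class_ring (quot_module M N)"
proof -
  interpret M: vectorspace class_ring M by fact
  have one: "1 \<odot>\<^bsub>M\<^esub> x = x" if "x \<in> carrier M" for x
    using M.smult_one[OF that] by simp
  have N': "Module.submodule N class_ring M"
  proof (rule M.submoduleI)
    fix a assume "a \<in> N"
    moreover from this have "a \<in> carrier M" using N LinearCombinations.submodule.subset by blast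
    ultimately show "\<ominus>\<^bsub>M\<^esub> a \<in> N"
      using LinearCombinations.submodule.smult_closed[OF N, of "-1" a] M.smult_l_minus[of 1 a]
      by (simp add: class_ring_simps one)
  qed (use N in \<open>auto simp: LinearCombinations.submodule_def\<close>)
  interpret N: abelian_subgroup N M
    by (rule abelian_subgroupI3)
       (use N' in \<open>auto simp: Module.submodule_def additive_subgroup_def M.abelian_group_axioms\<close>)
  let ?Q = "quot_module M N"
  have car: "carrier ?Q = (\<lambda>x. N +>\<^bsub>M\<^esub> x) ` carrier M"
    by (auto simp: quot_module_def A_RCOSETS_def')
  have add: "(N +>\<^bsub>M\<^esub> x) \<oplus>\<^bsub>?Q\<^esub> (N +>\<^bsub>M\<^esub> y) = N +>\<^bsub>M\<^esub> (x \<oplus>\<^bsub>M\<^esub> y)"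
    if "x \<in> carrier M" "y \<in> carrier M" for x y
    using N.a_rcos_sum that by (simp add: quot_module_def)
  have zero: "\<zero>\<^bsub>?Q\<^esub> = N +>\<^bsub>M\<^esub> \<zero>\<^bsub>M\<^esub>"
    by (simp add: quot_module_def N.a_subset)
  have smult: "a \<odot>\<^bsub>?Q\<^esub> (N +>\<^bsub>M\<^esub> x) = N +>\<^bsub>M\<^esub> (a \<odot>\<^bsub>M\<^esub> x)" if x: "x \<in> carrier M" for a x
  proof -
    have "N <+>\<^bsub>M\<^esub> (\<lambda>y. a \<odot>\<^bsub>M\<^esub> y) ` (N +>\<^bsub>M\<^esub> x) = N +>\<^bsub>M\<^esub> (a \<odot>\<^bsub>M\<^esub> x)" (is "?l = ?r")
    proof
      show "?l \<subseteq> ?r"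
      proof
        fix z assume "z \<in> ?l"
        then obtain n m where nm: "n \<in> N" "m \<in> N" "z = n \<oplus>\<^bsub>M\<^esub> (a \<odot>\<^bsub>M\<^esub> (m \<oplus>\<^bsub>M\<^esub> x))"
          by (auto simp: set_add_def' a_r_coset_def')
        then have c: "n \<in> carrier M" "m \<in> carrier M" using N.a_subset by auto
        have "z = (n \<oplus>\<^bsub>M\<^esub> (a \<odot>\<^bsub>M\<^esub> m)) \<oplus>\<^bsub>M\<^esub> (a \<odot>\<^bsub>M\<^esub> x)"
          using nm c x by (simp add: M.smult_r_distr M.a_assoc)
        moreover have "n \<oplus>\<^bsub>M\<^esub> (a \<odot>\<^bsub>M\<^esub> m) \<in> N" 
          using nm N by (auto simp: LinearCombinations.submodule_def)
        ultimately show "z \<in> ?r" by (auto simp: a_r_coset_def')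
      qed
      show "?r \<subseteq> ?l"
        using N.a_rcos_self[OF x] by (auto simp: a_r_coset_def'[of _ _ "a \<odot>\<^bsub>M\<^esub> x"] set_add_def')
    qed
    then show ?thesis by (simp add: quot_module_def)
  qed
  have ag: "abelian_group ?Q"
  proof (rule abelian_groupI)
    fix X assume "X \<in> carrier ?Q"
    then obtain x where x: "x \<in> carrier M" "X = N +>\<^bsub>M\<^esub> x" by (auto simp: car)
    then show "\<exists>Y\<in>carrier ?Q. Y \<oplus>\<^bsub>?Q\<^esub> X = \<zero>\<^bsub>?Q\<^esub>"
      by (intro bexI[of _ "N +>\<^bsub>M\<^esub> (\<ominus>\<^bsub>M\<^esub> x)"]) (auto simp: car add zero M.l_neg)
  qed (auto simp: car add zero M.a_ac)
  have "module class_ring ?Q"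
    by (rule moduleI[OF class_cring.is_cring ag])
       (auto simp: car add smult class_ring_simps M.smult_r_distr one
          M.smult_l_distr[simplified class_ring_simps] M.smult_assoc1[simplified class_ring_simps])
  then show ?thesis
    by (intro vectorspace.intro class_field.field_axioms)
qed

lemma tensor_kernel_submodule:
  fixes h :: "'f::field \<Rightarrow> 'e::field"
  assumes "vectorspace class_ring (V :: ('f, 'v) module)"
  shows "LinearCombinations.submodule class_ring (tensor_kernel h V) (free_vs (carrier V))"
    and "tensor_relations h V \<subseteq> carrier (free_vs (carrier V) :: ('e, 'v \<Rightarrow>\<^sub>0 'e) module)"
proof -
  interpret V: vectorspace class_ring V by fact
  interpret M: vectorspace class_ring "free_vs (carrier V) :: ('e, 'v \<Rightarrow>\<^sub>0 'e) module"
    by (rule vectorspace_free_vs)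
  show sub: "tensor_relations h V \<subseteq> carrier (free_vs (carrier V) :: ('e, 'v \<Rightarrow>\<^sub>0 'e) module)"
  proof
    fix c assume "c \<in> tensor_relations h V"
    then have "Poly_Mapping.keys c \<subseteq> carrier V"
      unfolding tensor_relations_def using V.smult_closed
      by (auto simp: in_keys_iff lookup_minus lookup_single when_def class_ring_simps split: if_splits)
    then show "c \<in> carrier (free_vs (carrier V))" by (simp add: free_vs_def)
  qed
  show "LinearCombinations.submodule class_ring (tensor_kernel h V) (free_vs (carrier V))"
    unfolding tensor_kernel_def using M.span_is_submodule[OF sub] .
qed

lemma vectorspace_tensor_vs:
  "vectorspace class_ring V \<Longrightarrow> vectorspace class_ring (tensor_vs h V)"
  unfolding tensor_vs_def
  by (intro vectorspace_quot_module vectorspace_free_vs tensor_kernel_submodule(1))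

lemma
  fixes h :: "'f::field \<Rightarrow> 'e::field" and \<phi> :: "('f, 'v) form"
  assumes \<phi>: "p_form p \<phi>" and h: "field_hom h"
  shows val_extend_form:
      "c \<in> carrier (free_vs (carrier (space \<phi>))) \<Longrightarrow>
       val (extend_form p h \<phi>) (tensor_kernel h (space \<phi>) +>\<^bsub>free_vs (carrier (space \<phi>))\<^esub> c) =
         (\<Sum>v\<in>Poly_Mapping.keys c. Poly_Mapping.lookup c v ^ p * h (val \<phi> v))"
    and val_extend_form_pure_tensor:
      "v \<in> carrier (space \<phi>) \<Longrightarrow>
       val (extend_form p h \<phi>) (pure_tensor h (space \<phi>) e v) = e ^ p * h (val \<phi> v)"
proof -
  interpret h: field_hom h by fact
  define V where "V = space \<phi>"
  interpret V: vectorspace class_ring V using \<phi> by (simp add: p_form_def V_def)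
  let ?M = "free_vs (carrier V) :: ('e, 'v \<Rightarrow>\<^sub>0 'e) module"
  interpret M: vectorspace class_ring ?M by (rule vectorspace_free_vs)
  let ?N = "tensor_kernel h V"
  note N = tensor_kernel_submodule(1)[OF V.vectorspace_axioms, of h]
  have p: "p > 0" "CHAR('f) = p" using \<phi> by (auto simp: p_form_def)
  have smultf: "val \<phi> (a \<odot>\<^bsub>V\<^esub> v) = a ^ p * val \<phi> v" if "v \<in> carrier V" for a v
    using \<phi> that by (auto simp: p_form_def V_def)
  have addf: "val \<phi> (v \<oplus>\<^bsub>V\<^esub> w) = val \<phi> v + val \<phi> w" if "v \<in> carrier V" "w \<in> carrier V" for w v
    using \<phi> that by (auto simp: p_form_def V_def)
  have charE: "CHAR('e) = p"
  proof (rule CHAR_eqI)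
    show "of_nat p = (0::'e)" using p h.hom_of_nat[of p] of_nat_CHAR[where ?'a='f] by simp
    show "p dvd n" if "of_nat n = (0::'e)" for n
      using that p h.hom_of_nat[of n] by (metis h.hom_0_iff of_nat_eq_0_iff_char_dvd)
  qed
  have prime: "prime CHAR('e)" using p charE by (intro prime_CHAR_semidom) simp
  define q where "q c = (\<Sum>v\<in>Poly_Mapping.keys c. Poly_Mapping.lookup c v ^ p * h (val \<phi> v))" for c
  have q_sup: "q c = (\<Sum>v\<in>A. Poly_Mapping.lookup c v ^ p * h (val \<phi> v))"
    if "finite A" "Poly_Mapping.keys c \<subseteq> A" for c A
    unfolding q_def using that p
    by (intro sum.mono_neutral_left) (auto simp: in_keys_iff)
  have pow_add: "(x + y) ^ p = x ^ p + y ^ p" for x y :: 'e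
    using freshmans_dream[OF prime refl, of x y] by (simp add: charE)
  have q_add: "q (c + d) = q c + q d" for c d
  proof -
    let ?A = "Poly_Mapping.keys c \<union> Poly_Mapping.keys d"
    have "q (c + d) = (\<Sum>v\<in>?A. Poly_Mapping.lookup (c + d) v ^ p * h (val \<phi> v))"
      by (rule q_sup) (auto simp: in_keys_iff lookup_add)
    also have "\<dots> = (\<Sum>v\<in>?A. Poly_Mapping.lookup c v ^ p * h (val \<phi> v)) +
        (\<Sum>v\<in>?A. Poly_Mapping.lookup d v ^ p * h (val \<phi> v))"
      by (simp add: lookup_add pow_add distrib_right sum.distrib)
    also have "\<dots> = q c + q d" using q_sup[of ?A c] q_sup[of ?A d] by simp
    finally show ?thesis .
  qed
  have q_diff: "q (c - d) = q c - q d" for c d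
    using q_add[of "c - d" d] by (simp add: algebra_simps)
  have q_smult: "q (Poly_Mapping.map ((*) a) c) = a ^ p * q c" for a c
  proof -
    have "q (Poly_Mapping.map ((*) a) c) =
      (\<Sum>v\<in>Poly_Mapping.keys c. Poly_Mapping.lookup (Poly_Mapping.map ((*) a) c) v ^ p * h (val \<phi> v))"
      by (rule q_sup) (auto intro: keys_smult[THEN subsetD])
    then show ?thesis by (simp add: lookup_smult q_def sum_distrib_left power_mult_distrib mult_ac)
  qed
  have q_single: "q (Poly_Mapping.single v e) = e ^ p * h (val \<phi> v)" for v e
    using q_sup[of "{v}" "Poly_Mapping.single v e"] by simp
  have "?N \<subseteq> {c \<in> carrier ?M. q c = 0}"
    unfolding tensor_kernel_def
  proof (rule M.span_is_subset)
    show "tensor_relations h V \<subseteq> {c \<in> carrier ?M. q c = 0}"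
      using tensor_kernel_submodule(2)[OF V.vectorspace_axioms, of h]
      by (auto simp: tensor_relations_def q_diff q_single smultf addf h.hom_mult h.hom_add h.hom_power)
    have "q 0 = 0" by (simp add: q_def)
    then show "LinearCombinations.submodule class_ring {c \<in> carrier ?M. q c = 0} ?M"
      using M.a_closed M.zero_closed M.smult_closed
      by (auto simp: LinearCombinations.submodule_def M.module_axioms)
         (auto simp: free_vs_def q_add q_smult)
  qed
  then have q_N: "q n = 0" if "n \<in> ?N" for n using that by auto
  have val: "val (extend_form p h \<phi>) (?N +>\<^bsub>?M\<^esub> c) = q c" if c: "c \<in> carrier ?M" for c
  proof -
    have "\<zero>\<^bsub>?M\<^esub> \<in> ?N" using N by (auto simp: LinearCombinations.submodule_def)
    then have "q ` (?N +>\<^bsub>?M\<^esub> c) = {q c}"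
      by (auto simp: a_r_coset_def' free_vs_def q_add q_N image_iff)
    then show ?thesis by (simp add: extend_form_def q_def[abs_def])
  qed
  show "val (extend_form p h \<phi>) (tensor_kernel h (space \<phi>) +>\<^bsub>free_vs (carrier (space \<phi>))\<^esub> c) =
      (\<Sum>v\<in>Poly_Mapping.keys c. Poly_Mapping.lookup c v ^ p * h (val \<phi> v))"
    if "c \<in> carrier (free_vs (carrier (space \<phi>)))" for c
    using val that by (simp add: V_def q_def)
  show "val (extend_form p h \<phi>) (pure_tensor h (space \<phi>) e v) = e ^ p * h (val \<phi> v)"
    if "v \<in> carrier (space \<phi>)" for e v
    using val[of "Poly_Mapping.single v e"] that
    by (auto simp: pure_tensor_def V_def[symmetric] free_vs_def q_single)
qed


section \<open>Vishik equivalence\<close>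

text \<open>
  Field extensions are given by field homomorphisms into a field type. A definition cannot quantify
  over types, so the type of the extension field is a parameter: Vishik equivalence is the statement
  that \<open>vishik_equivalent TYPE('e) p \<phi> \<psi>\<close> holds for an unconstrained type variable of class field.
\<close>

definition vishik_equivalent ::
    "'e::field itself \<Rightarrow> nat \<Rightarrow> ('f::field, 'v) form \<Rightarrow> ('f, 'w) form \<Rightarrow> bool" where
  "vishik_equivalent _ p \<phi> \<psi> \<longleftrightarrow>
     form_dim \<phi> = form_dim \<psi> \<and>
     (\<forall>h :: 'f \<Rightarrow> 'e. field_hom h \<longrightarrow>
        defect p (extend_form p h \<phi>) = defect p (extend_form p h \<psi>))"

end

theory Submission
  imports Defs "Jordan_Normal_Form.Char_Poly"
begin

text \<open>
  Vishik equivalence. Let \<open>h : F \<rightarrow> E\<close> be an extension. The extended form \<open>\<langle>1, b\<rangle>\<^sub>E\<close> is isometric to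
  \<open>\<langle>1, h(b)\<rangle>\<close> (\<open>isometric_extend_diag_form\<close>), and over \<open>E\<close> there are only two possibilities. If \<open>h(b)\<close> is
  a \<open>p\<close>-th power, the substitution \<open>x + c y\<close> for \<open>x\<close>, where \<open>c\<^sup>p = h(b)\<close>, turns \<open>\<langle>1, h(b)\<rangle>\<close> into
  \<open>\<langle>1, 0\<rangle>\<close>; otherwise \<open>\<langle>1, h(b)\<rangle>\<close> is anisotropic and its defect is \<open>0\<close>. Because \<open>p\<close> is odd, \<open>h(a)\<close> and
  \<open>h(a\<^sup>2)\<close> are \<open>p\<close>-th powers simultaneously (\<open>pth_power_if_coprime_power\<close>), so in both cases the defects
  of \<open>\<langle>1, a\<rangle>\<^sub>E\<close> and \<open>\<langle>1, a\<^sup>2\<rangle>\<^sub>E\<close> agree.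

  No similarity. If \<open>\<langle>1, a\<rangle>\<close> were similar to \<open>\<langle>1, a\<^sup>2\<rangle>\<close>, there would be two values of \<open>\<langle>1, a\<^sup>2\<rangle>\<close> with
  ratio \<open>a\<close>, that is \<open>a (x\<^sup>p + a\<^sup>2 y\<^sup>p) = u\<^sup>p + a\<^sup>2 v\<^sup>p\<close> with \<open>(x, y) \<noteq> (0, 0)\<close>. This is a cubic relation for \<open>a\<close>
  with coefficients in \<open>F\<^sup>p\<close>. But \<open>a\<close> has degree \<open>p > 3\<close> over \<open>F\<^sup>p\<close> (\<open>poly_frobenius_nonzero\<close>).
\<close>

section \<open>Degree over the subfield of p-th powers\<close>

text \<open>Since \<open>d\<close> is invertible modulo \<open>p\<close>, some power \<open>(a\<^sup>d)\<^sup>u\<close> is \<open>a\<close> times a \<open>p\<close>-th power.\<close>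

lemma pth_power_if_coprime_power:
  fixes a :: "'f::field"
  assumes "coprime d p" "d \<noteq> 0" "p \<noteq> 0" "a ^ d = x ^ p"
  shows "\<exists>y. a = y ^ p"
proof (cases "a = 0")
  case True
  then have "a = 0 ^ p" using assms by simp
  then show ?thesis ..
next
  case False
  obtain u v where uv: "d * u = p * v + 1"
    using bezout_nat[OF assms(2), of p] assms(1) by (auto simp: coprime_iff_gcd_eq_1)
  have "(x ^ u) ^ p = (a ^ d) ^ u"
    by (metis assms(4) power_mult mult.commute)
  also have "\<dots> = a ^ (p * v + 1)" by (metis uv power_mult)
  also have "\<dots> = (a ^ v) ^ p * a" by (simp add: power_add mult.commute flip: power_mult)
  finally have "a = (x ^ u / a ^ v) ^ p" using False by (simp add: power_divide)
  then show ?thesis ..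
qed

lemma field_hom_frobenius:
  assumes "prime p" "CHAR('f::field) = p"
  shows "field_hom (\<lambda>x::'f. x ^ p)"
proof
  fix x y :: 'f
  have "prime CHAR('f)" using assms by simp
  then show "(x + y) ^ p = x ^ p + y ^ p"
    using freshmans_dream[OF _ refl, of x y] assms by simp
qed (use assms prime_gt_0_nat[of p] in \<open>auto simp: power_mult_distrib\<close>)

text \<open>
  A polynomial with coefficients in \<open>F\<^sup>p\<close> is the image of a polynomial over \<open>F\<close> under the Frobenius map
  \<open>h\<close>, so the statement says that \<open>a\<close> has degree at least \<open>p\<close> over \<open>F\<^sup>p\<close>. If \<open>h(m)\<close> is a polynomial of
  minimal degree \<open>d\<close> over \<open>F\<^sup>p\<close> with root \<open>a\<close>, it divides \<open>X\<^sup>p - a\<^sup>p = (X - a)\<^sup>p\<close>, hence it is a scalar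
  multiple of \<open>(X - a)\<^sup>d\<close>. Its constant term shows \<open>(-a)\<^sup>d \<in> F\<^sup>p\<close>, which is impossible for \<open>0 < d < p\<close>.
\<close>

lemma poly_frobenius_nonzero:
  fixes a :: "'f::field"
  assumes p: "prime p" "CHAR('f) = p" and a: "a \<notin> range (\<lambda>x::'f. x ^ p)"
    and P: "P \<noteq> 0" "degree P < p"
  shows "poly (map_poly (\<lambda>x. x ^ p) P) a \<noteq> 0"
proof
  define h where "h = (\<lambda>x::'f. x ^ p)"
  interpret h: field_hom h unfolding h_def using p by (rule field_hom_frobenius)
  interpret hp: map_poly_inj_comm_ring_hom h ..
  assume "poly (map_poly (\<lambda>x. x ^ p) P) a = 0"
  then have root: "poly (map_poly h P) a = 0" by (simp add: h_def)
  then obtain m where m: "m \<noteq> 0" "poly (map_poly h m) a = 0"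
    and least: "\<And>r. r \<noteq> 0 \<Longrightarrow> poly (map_poly h r) a = 0 \<Longrightarrow> degree m \<le> degree r"
    using P ex_has_least_nat[of "\<lambda>P. P \<noteq> 0 \<and> poly (map_poly h P) a = 0" P degree] root by metis
  define d where "d = degree m"
  have "d < p" using least[of P] P root by (simp add: d_def)
  have "d \<noteq> 0"
  proof
    assume "d = 0"
    then obtain c where "m = [:c:]" using degree_0_id[of m] by (metis d_def)
    with m show False by simp
  qed
  let ?X = "monom 1 p - [:a:] :: 'f poly"
  have X: "map_poly h ?X = [:-a, 1:] ^ p"
  proof -
    have "map_poly h ?X = monom 1 p - [:a ^ p:]"
      by (simp add: hp.hom_minus h.map_poly_pCons_hom) (simp add: h_def)
    also have "\<dots> = [:-a, 1:] ^ p"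
    proof -
      have "[:-a, 1:] ^ p = (monom 1 1 + [:-a:]) ^ p" by (simp add: monom_altdef)
      also have "\<dots> = monom 1 1 ^ p + [:-a:] ^ p"
        using p by (intro freshmans_dream) auto
      also have "\<dots> = monom 1 p - [:a ^ p:]"
        using h.hom_uminus[of a] by (simp add: monom_power poly_const_pow h_def)
      finally show ?thesis ..
    qed
    finally show ?thesis .
  qed
  \<comment> \<open>Division by \<open>m\<close> takes place in \<open>F[X]\<close>; transporting it along \<open>h\<close> keeps the degree of the
    remainder, so minimality of \<open>m\<close> forces the remainder to vanish.\<close>
  have "m dvd ?X"
  proof -
    have "[:-a, 1:] ^ p = map_poly h (?X div m) * map_poly h m + map_poly h (?X mod m)"
      unfolding X[symmetric] by (metis div_mult_mod_eq hp.hom_add hp.hom_mult)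
    from arg_cong[OF this, of "\<lambda>q. poly q a"]
    have "poly (map_poly h (?X mod m)) a = 0"
      using m(2) p prime_gt_0_nat[of p] by (simp add: power_0_left)
    with m(1) least[of "?X mod m"] have "?X mod m = 0"
      using degree_mod_less'[of m ?X] by (cases "?X mod m = 0") auto
    then show ?thesis by auto
  qed
  then obtain q where "?X = m * q" ..
  then have mq: "[:-a, 1:] ^ p = map_poly h m * map_poly h q" using X by (metis hp.hom_mult)
  then have nz: "map_poly h m * map_poly h q \<noteq> 0" by (metis pCons_eq_0_iff power_not_zero zero_neq_one)
  \<comment> \<open>In the product \<open>h(m) h(q) = (X - a)\<^sup>p\<close> the orders at \<open>a\<close> add up to the sum of the degrees, so
    \<open>X - a\<close> is the only irreducible factor of \<open>h(m)\<close>.\<close>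
  have "order a (map_poly h m) + order a (map_poly h q) = p"
    using order_mult[OF nz] mq order_power_n_n[of a p] by simp
  moreover have "order a (map_poly h m) \<le> d" "order a (map_poly h q) \<le> degree q"
    using nz order_degree[of "map_poly h m" a] order_degree[of "map_poly h q" a] by (auto simp: d_def)
  moreover have "d + degree q = p"
    using degree_mult_eq[of "map_poly h m" "map_poly h q"] nz mq degree_linear_power[of "-a" p]
    by (auto simp: d_def)
  ultimately have "order a (map_poly h m) = d" by linarith
  then obtain r where r: "map_poly h m = [:-a, 1:] ^ d * r"
    using order_1[of a "map_poly h m"] by (metis dvdE)
  have "degree ([:-a, 1:] ^ d * r) = d" unfolding r[symmetric] by (simp add: d_def)
  then have "degree r = 0"
    using nz r degree_mult_eq[of "[:-a, 1:] ^ d" r] degree_linear_power[of "-a" d] by auto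
  then obtain c where c: "r = [:c:]" using degree_0_id[of r] by metis
  then have "c \<noteq> 0" using r nz by auto
  have "h (lead_coeff m) = lead_coeff (map_poly h m)" by simp
  also have "\<dots> = c" unfolding r c by (simp add: lead_coeff_mult lead_coeff_power)
  finally have "c = h (lead_coeff m)" ..
  moreover have "h (poly m 0) = poly (map_poly h m) 0" by (metis h.poly_map_poly h.hom_zero)
  then have "h (poly m 0) = (-a) ^ d * c" by (simp add: r c)
  ultimately have "(-a) ^ d = (poly m 0 / lead_coeff m) ^ p"
    using \<open>c \<noteq> 0\<close> by (simp add: h_def power_divide)
  moreover have "coprime d p"
    using p \<open>d < p\<close> \<open>d \<noteq> 0\<close> by (metis coprime_commute dvd_imp_le not_le prime_imp_coprime neq0_conv)
  ultimately obtain y where "- a = h y"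
    using pth_power_if_coprime_power[of d p "-a"] \<open>d \<noteq> 0\<close> p unfolding h_def by (metis not_prime_0)
  then have "a = h (- y)" by (metis h.hom_uminus minus_minus)
  then show False using a by (auto simp: h_def)
qed

section \<open>Isometries and the defect\<close>

lemma isometric_trans:
  assumes "isometric \<phi> \<psi>" "isometric \<psi> \<chi>"
  shows "isometric \<phi> \<chi>"
proof -
  obtain f g where
    f: "f \<in> LinearCombinations.module_hom class_ring (space \<phi>) (space \<psi>)"
      "bij_betw f (carrier (space \<phi>)) (carrier (space \<psi>))"
      "\<forall>v\<in>carrier (space \<phi>). val \<phi> v = val \<psi> (f v)" and
    g: "g \<in> LinearCombinations.module_hom class_ring (space \<psi>) (space \<chi>)"
      "bij_betw g (carrier (space \<psi>)) (carrier (space \<chi>))"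
      "\<forall>v\<in>carrier (space \<psi>). val \<psi> v = val \<chi> (g v)"
    using assms by (auto simp: isometric_def)
  have closed: "f v \<in> carrier (space \<psi>)" if "v \<in> carrier (space \<phi>)" for v
    using f(2) that by (rule bij_betwE[THEN bspec])
  show ?thesis
    unfolding isometric_def
  proof (intro bexI[of _ "g \<circ> f"] conjI)
    show "g \<circ> f \<in> LinearCombinations.module_hom class_ring (space \<phi>) (space \<chi>)"
      using f(1) g(1) by (auto simp: LinearCombinations.module_hom_def Pi_iff)
    show "bij_betw (g \<circ> f) (carrier (space \<phi>)) (carrier (space \<chi>))"
      using f(2) g(2) by (rule bij_betw_trans)
    show "\<forall>v\<in>carrier (space \<phi>). val \<phi> v = val \<chi> ((g \<circ> f) v)"
      using f(3) g(3) closed by simp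
  qed
qed

lemma isometric_sym:
  fixes \<phi> :: "('f::field, 'v) form"
  assumes V: "vectorspace class_ring (space \<phi>)" and iso: "isometric \<phi> \<psi>"
  shows "isometric \<psi> \<phi>"
proof -
  interpret V: vectorspace class_ring "space \<phi>" by fact
  obtain f where
    f: "f \<in> LinearCombinations.module_hom class_ring (space \<phi>) (space \<psi>)"
      "bij_betw f (carrier (space \<phi>)) (carrier (space \<psi>))"
      "\<forall>v\<in>carrier (space \<phi>). val \<phi> v = val \<psi> (f v)"
    using iso by (auto simp: isometric_def)
  define g where "g = inv_into (carrier (space \<phi>)) f"
  have g: "bij_betw g (carrier (space \<psi>)) (carrier (space \<phi>))"
    unfolding g_def using f(2) by (rule bij_betw_inv_into)
  have closed: "g w \<in> carrier (space \<phi>)" if "w \<in> carrier (space \<psi>)" for w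
    using g that by (rule bij_betwE[THEN bspec])
  have fg: "f (g w) = w" if "w \<in> carrier (space \<psi>)" for w
    unfolding g_def using f(2) that by (rule bij_betw_inv_into_right)
  have gf: "g (f v) = v" if "v \<in> carrier (space \<phi>)" for v
    unfolding g_def using f(2) that by (rule bij_betw_inv_into_left)
  show ?thesis
    unfolding isometric_def
  proof (intro bexI[of _ g] conjI)
    show "g \<in> LinearCombinations.module_hom class_ring (space \<psi>) (space \<phi>)"
      unfolding LinearCombinations.module_hom_def
    proof (intro CollectI conjI allI impI)
      show "g \<in> carrier (space \<psi>) \<rightarrow> carrier (space \<phi>)" using closed by auto
    next
      fix x y assume xy: "x \<in> carrier (space \<psi>) \<and> y \<in> carrier (space \<psi>)"
      then have "f (g x \<oplus>\<^bsub>space \<phi>\<^esub> g y) = x \<oplus>\<^bsub>space \<psi>\<^esub> y"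
        using LinearCombinations.module_hom_add[OF f(1) closed closed] fg by simp
      then show "g (x \<oplus>\<^bsub>space \<psi>\<^esub> y) = g x \<oplus>\<^bsub>space \<phi>\<^esub> g y"
        using gf xy closed by (metis V.a_closed)
    next
      fix r :: 'f and x assume rx: "r \<in> carrier class_ring \<and> x \<in> carrier (space \<psi>)"
      then have "f (r \<odot>\<^bsub>space \<phi>\<^esub> g x) = r \<odot>\<^bsub>space \<psi>\<^esub> x"
        using LinearCombinations.module_hom_smult[OF f(1) _ closed] fg by simp
      then show "g (r \<odot>\<^bsub>space \<psi>\<^esub> x) = r \<odot>\<^bsub>space \<phi>\<^esub> g x"
        using gf rx closed by (metis V.smult_closed)
    qed
    show "\<forall>w\<in>carrier (space \<psi>). val \<psi> w = val \<phi> (g w)"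
      using f(3) closed fg by simp
  qed (rule g)
qed

lemma module_hom_zero:
  assumes "vectorspace class_ring V" "vectorspace class_ring W"
    "f \<in> LinearCombinations.module_hom class_ring V W"
  shows "f \<zero>\<^bsub>V\<^esub> = \<zero>\<^bsub>W\<^esub>"
proof -
  interpret V: vectorspace class_ring V by fact
  interpret W: vectorspace class_ring W by fact
  interpret mod_hom class_ring V W f
    using assms(3) by unfold_locales auto
  show ?thesis by (rule f0_is_0)
qed

lemma p_form_isometric:
  fixes \<phi> :: "('f::field, 'v) form"
  assumes \<phi>: "p_form p \<phi>" and W: "vectorspace class_ring (space \<psi>)" and iso: "isometric \<phi> \<psi>"
  shows "p_form p \<psi>"
proof -
  obtain f where
    f: "f \<in> LinearCombinations.module_hom class_ring (space \<phi>) (space \<psi>)"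
      "bij_betw f (carrier (space \<phi>)) (carrier (space \<psi>))"
      "\<forall>v\<in>carrier (space \<phi>). val \<phi> v = val \<psi> (f v)"
    using iso by (auto simp: isometric_def)
  interpret V: vectorspace class_ring "space \<phi>" using \<phi> by (simp add: p_form_def)
  interpret W: vectorspace class_ring "space \<psi>" by fact
  interpret f: linear_map class_ring "space \<phi>" "space \<psi>" f
    using f(1) by unfold_locales auto
  have surj: "f ` carrier (space \<phi>) = carrier (space \<psi>)" using f(2) by (simp add: bij_betw_def)
  have "W.fin_dim"
    using f.surj_fin_dim[OF _ surj] \<phi> by (simp add: p_form_def)
  moreover have "val \<psi> (a \<odot>\<^bsub>space \<psi>\<^esub> w) = a ^ p * val \<psi> w" if "w \<in> carrier (space \<psi>)" for a w
  proof -
    from that surj obtain v where v: "v \<in> carrier (space \<phi>)" "w = f v" by auto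
    then have "a \<odot>\<^bsub>space \<psi>\<^esub> w = f (a \<odot>\<^bsub>space \<phi>\<^esub> v)" by simp
    then show ?thesis using f(3) v \<phi> V.smult_closed[of a v] by (simp add: p_form_def)
  qed
  moreover have "val \<psi> (w \<oplus>\<^bsub>space \<psi>\<^esub> w') = val \<psi> w + val \<psi> w'"
    if "w \<in> carrier (space \<psi>)" "w' \<in> carrier (space \<psi>)" for w w'
  proof -
    from that surj obtain v v' where
      v: "v \<in> carrier (space \<phi>)" "w = f v" "v' \<in> carrier (space \<phi>)" "w' = f v'" by blast
    then have "w \<oplus>\<^bsub>space \<psi>\<^esub> w' = f (v \<oplus>\<^bsub>space \<phi>\<^esub> v')" by simp
    then show ?thesis using f(3) v \<phi> V.a_closed[of v v'] by (simp add: p_form_def)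
  qed
  ultimately show ?thesis using \<phi> W by (simp add: p_form_def)
qed

lemma anisotropic_isometric:
  assumes V: "vectorspace class_ring (space \<phi>)" and W: "vectorspace class_ring (space \<psi>)"
    and iso: "isometric \<phi> \<psi>" and an: "anisotropic \<phi>"
  shows "anisotropic \<psi>"
  unfolding anisotropic_def
proof (intro ballI impI)
  obtain f where
    f: "f \<in> LinearCombinations.module_hom class_ring (space \<phi>) (space \<psi>)"
      "bij_betw f (carrier (space \<phi>)) (carrier (space \<psi>))"
      "\<forall>v\<in>carrier (space \<phi>). val \<phi> v = val \<psi> (f v)"
    using iso by (auto simp: isometric_def)
  fix w assume w: "w \<in> carrier (space \<psi>)" "val \<psi> w = 0"
  then obtain v where v: "v \<in> carrier (space \<phi>)" "w = f v"
    using f(2) by (auto simp: bij_betw_def)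
  then have "v = \<zero>\<^bsub>space \<phi>\<^esub>" using w f(3) an by (simp add: anisotropic_def)
  then show "w = \<zero>\<^bsub>space \<psi>\<^esub>" using v module_hom_zero[OF V W f(1)] by simp
qed

text \<open>
  The decompositions that define the defect involve the form only through its isometry class.
\<close>

lemma defect_isometric:
  fixes \<phi> \<psi> :: "('f::field, 'v) form"
  assumes V: "vectorspace class_ring (space \<phi>)" and iso: "isometric \<phi> \<psi>"
  shows "defect p \<phi> = defect p \<psi>"
proof -
  have "isometric \<phi> \<chi> \<longleftrightarrow> isometric \<psi> \<chi>" for \<chi> :: "('f, 'v \<times> 'f vec) form"
    using iso isometric_sym[OF V iso] isometric_trans by blast
  then show ?thesis by (simp add: defect_def)
qed

text \<open>
  An anisotropic form is its own anisotropic part. Conversely, anisotropy passes to every form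
  isometric to \<open>\<phi>\<close>, and an orthogonal sum with a zero form of positive dimension is isotropic.
\<close>

lemma defect_anisotropic:
  fixes \<phi> :: "('f::field, 'v) form"
  assumes \<phi>: "p_form p \<phi>" and an: "anisotropic \<phi>"
  shows "defect p \<phi> = 0"
  unfolding defect_def
proof (rule the_equality)
  interpret V: vectorspace class_ring "space \<phi>" using \<phi> by (simp add: p_form_def)
  have vec0: "carrier_vec 0 = {0\<^sub>v 0 :: 'f vec}" by auto
  have "isometric \<phi> (orth_sum \<phi> (diag_form p []))"
    unfolding isometric_def
    by (rule bexI[of _ "\<lambda>v. (v, 0\<^sub>v 0)"])
       (auto simp: bij_betw_def inj_on_def image_iff LinearCombinations.module_hom_def
          orth_sum_def diag_form_def direct_sum_def module_vec_simps vec0)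
  then show "\<exists>\<alpha> :: ('f, 'v) form. p_form p \<alpha> \<and> anisotropic \<alpha> \<and>
      isometric \<phi> (orth_sum \<alpha> (diag_form p (replicate 0 0)))"
    using \<phi> an by auto
next
  fix k
  assume "\<exists>\<alpha> :: ('f, 'v) form. p_form p \<alpha> \<and> anisotropic \<alpha> \<and>
      isometric \<phi> (orth_sum \<alpha> (diag_form p (replicate k 0)))"
  then obtain \<alpha> :: "('f, 'v) form" where \<alpha>: "p_form p \<alpha>"
    and iso: "isometric \<phi> (orth_sum \<alpha> (diag_form p (replicate k 0)))" by blast
  interpret V: vectorspace class_ring "space \<phi>" using \<phi> by (simp add: p_form_def)
  interpret A: vectorspace class_ring "space \<alpha>" using \<alpha> by (simp add: p_form_def)
  let ?\<psi> = "orth_sum \<alpha> (diag_form p (replicate k 0))"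
  interpret K: vec_space "TYPE('f)" k .
  have W: "vectorspace class_ring (space ?\<psi>)"
    using direct_sum_is_vs[OF A.vectorspace_axioms K.vectorspace_axioms]
    by (simp add: orth_sum_def diag_form_def)
  \<comment> \<open>If \<open>k > 0\<close>, the first basis vector of the zero form would be an isotropic vector.\<close>
  have "anisotropic ?\<psi>"
    using V.vectorspace_axioms W iso an by (rule anisotropic_isometric)
  moreover have "val \<alpha> \<zero>\<^bsub>space \<alpha>\<^esub> = 0"
  proof -
    have "val \<alpha> (\<zero>\<^bsub>space \<alpha>\<^esub> \<oplus>\<^bsub>space \<alpha>\<^esub> \<zero>\<^bsub>space \<alpha>\<^esub>) = val \<alpha> \<zero>\<^bsub>space \<alpha>\<^esub> + val \<alpha> \<zero>\<^bsub>space \<alpha>\<^esub>"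
      using \<alpha> unfolding p_form_def by (metis A.zero_closed)
    then show ?thesis by (metis A.r_zero A.zero_closed add_cancel_right_left)
  qed
  ultimately have "(\<zero>\<^bsub>space \<alpha>\<^esub>, unit_vec k 0) = \<zero>\<^bsub>space ?\<psi>\<^esub>"
    by (auto simp: anisotropic_def orth_sum_def diag_form_def direct_sum_def module_vec_simps)
  then have "unit_vec k 0 = (0\<^sub>v k :: 'f vec)"
    by (simp add: orth_sum_def diag_form_def direct_sum_def module_vec_simps)
  then show "k = 0" using unit_vec_nonzero[of 0 k] by (metis neq0_conv)
qed

section \<open>Extension of scalars of a diagonal form\<close>

lemma free_vs_simps:
  "carrier (free_vs S) = {c :: 'v \<Rightarrow>\<^sub>0 'e::field. Poly_Mapping.keys c \<subseteq> S}"
  "c \<oplus>\<^bsub>free_vs S\<^esub> d = c + d" "\<zero>\<^bsub>free_vs S\<^esub> = 0"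
  "e \<odot>\<^bsub>free_vs S\<^esub> c = Poly_Mapping.map ((*) e) c"
  for c d :: "'v \<Rightarrow>\<^sub>0 'e::field"
  by (simp_all add: free_vs_def)

lemma quot_module_simps:
  "X \<oplus>\<^bsub>quot_module M N\<^esub> Y = X <+>\<^bsub>M\<^esub> Y"
  "a \<odot>\<^bsub>quot_module M N\<^esub> X = N <+>\<^bsub>M\<^esub> (\<lambda>x. a \<odot>\<^bsub>M\<^esub> x) ` X"
  "carrier (quot_module M N) = (\<lambda>x. N +>\<^bsub>M\<^esub> x) ` carrier M"
  by (auto simp: quot_module_def A_RCOSETS_def')

lemma map_mult_add:
  "Poly_Mapping.map ((*) (a :: 'e::field)) (c + d) = Poly_Mapping.map ((*) a) c + Poly_Mapping.map ((*) a) d"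
  by (intro poly_mapping_eqI) (simp add: lookup_smult lookup_add distrib_left)

lemma map_mult_diff:
  "Poly_Mapping.map ((*) (a :: 'e::field)) (c - d) = Poly_Mapping.map ((*) a) c - Poly_Mapping.map ((*) a) d"
  by (intro poly_mapping_eqI) (simp add: lookup_smult lookup_minus right_diff_distrib)

lemma map_mult_single:
  "Poly_Mapping.map ((*) (a :: 'e::field)) (Poly_Mapping.single v e) = Poly_Mapping.single v (a * e)"
  by (intro poly_mapping_eqI) (simp add: lookup_smult lookup_single when_def)

lemma free_vs_submoduleD:
  fixes N :: "('v \<Rightarrow>\<^sub>0 'e::field) set"
  assumes N: "LinearCombinations.submodule class_ring N (free_vs S)"
  shows "0 \<in> N"
    and "c \<in> N \<Longrightarrow> d \<in> N \<Longrightarrow> c + d \<in> N"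
    and "c \<in> N \<Longrightarrow> d \<in> N \<Longrightarrow> c - d \<in> N"
    and "c \<in> N \<Longrightarrow> Poly_Mapping.map ((*) a) c \<in> N"
proof -
  show zero: "0 \<in> N"
    using LinearCombinations.submodule.zero_closed[OF N] by (simp add: free_vs_simps)
  show add: "c + d \<in> N" if "c \<in> N" "d \<in> N" for c d
    using LinearCombinations.submodule.m_closed[OF N that] by (simp add: free_vs_simps)
  show smult: "Poly_Mapping.map ((*) a) c \<in> N" if "c \<in> N" for a c
    using LinearCombinations.submodule.smult_closed[OF N _ that, of a] by (simp add: free_vs_simps)
  show "c - d \<in> N" if "c \<in> N" "d \<in> N" for c d
  proof -
    have "c - d = c + Poly_Mapping.map ((*) (-1)) d"
      by (intro poly_mapping_eqI) (simp add: lookup_smult lookup_add lookup_minus)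
    then show ?thesis using add[OF that(1) smult[OF that(2), of "-1"]] by (simp only:)
  qed
qed

lemma free_vs_cosets:
  fixes N :: "('v \<Rightarrow>\<^sub>0 'e::field) set" and S :: "'v set"
  defines "M \<equiv> free_vs S :: ('e, 'v \<Rightarrow>\<^sub>0 'e) module"
  assumes N: "LinearCombinations.submodule class_ring N M"
  shows "N +>\<^bsub>M\<^esub> c = N +>\<^bsub>M\<^esub> d \<longleftrightarrow> c - d \<in> N"
    and "(N +>\<^bsub>M\<^esub> c) \<oplus>\<^bsub>quot_module M N\<^esub> (N +>\<^bsub>M\<^esub> d) = N +>\<^bsub>M\<^esub> (c + d)"
    and "a \<odot>\<^bsub>quot_module M N\<^esub> (N +>\<^bsub>M\<^esub> c) = N +>\<^bsub>M\<^esub> Poly_Mapping.map ((*) a) c"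
proof -
  note N_rules = free_vs_submoduleD[OF N[unfolded M_def]]
  have coset: "N +>\<^bsub>M\<^esub> c = (\<lambda>m. m + c) ` N" for c
    by (auto simp: a_r_coset_def' M_def free_vs_simps)
  show "N +>\<^bsub>M\<^esub> c = N +>\<^bsub>M\<^esub> d \<longleftrightarrow> c - d \<in> N"
  proof
    assume "N +>\<^bsub>M\<^esub> c = N +>\<^bsub>M\<^esub> d"
    then have "c \<in> (\<lambda>m. m + d) ` N" using N_rules(1) by (force simp: coset)
    then show "c - d \<in> N" by auto
  next
    assume cd: "c - d \<in> N"
    have "m + c = (m + (c - d)) + d" "m + d = (m - (c - d)) + c" for m by simp_all
    then show "N +>\<^bsub>M\<^esub> c = N +>\<^bsub>M\<^esub> d"
      unfolding coset using N_rules(2)[OF _ cd] N_rules(3)[OF _ cd] by (blast intro: image_eqI)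
  qed
  have "\<exists>m1\<in>N. \<exists>m2\<in>N. m + (c + d) = (m1 + c) + (m2 + d)" if "m \<in> N" for m
    using that N_rules(1) by (intro bexI[of _ m] bexI[of _ 0]) (auto simp: algebra_simps)
  moreover have "(m1 + c) + (m2 + d) = (m1 + m2) + (c + d)" for m1 m2
    by (simp add: algebra_simps)
  ultimately show "(N +>\<^bsub>M\<^esub> c) \<oplus>\<^bsub>quot_module M N\<^esub> (N +>\<^bsub>M\<^esub> d) = N +>\<^bsub>M\<^esub> (c + d)"
    using N_rules(2)
    by (auto simp: quot_module_simps set_add_def' coset image_iff) (auto simp: M_def free_vs_simps)
  let ?s = "Poly_Mapping.map ((*) a) :: ('v \<Rightarrow>\<^sub>0 'e) \<Rightarrow> _"
  have "m1 + ?s (m2 + c) = (m1 + ?s m2) + ?s c" for m1 m2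
    by (simp add: map_mult_add)
  moreover have "\<exists>m1\<in>N. \<exists>m2\<in>N. m + ?s c = m1 + ?s (m2 + c)" if "m \<in> N" for m
    using that N_rules(1) by (intro bexI[of _ m] bexI[of _ 0]) auto
  ultimately show "a \<odot>\<^bsub>quot_module M N\<^esub> (N +>\<^bsub>M\<^esub> c) = N +>\<^bsub>M\<^esub> ?s c"
    using N_rules(2,4)
    by (auto simp: quot_module_simps set_add_def' coset image_iff) (auto simp: M_def free_vs_simps)
qed

text \<open>
  The easy half of the universal property of \<open>E \<otimes>\<^sub>F V\<close>: a semilinear functional \<open>g\<close> on \<open>V\<close> induces a
  linear functional on the tensor product. Coordinate functionals separate the tensors \<open>\<Sum>\<^sub>i x\<^sub>i \<otimes> e\<^sub>i\<close>.
\<close>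

lemma tensor_kernel_functional:
  fixes h :: "'f::field \<Rightarrow> 'e::field" and g :: "'v \<Rightarrow> 'e"
  defines "s \<equiv> \<lambda>c. \<Sum>v\<in>Poly_Mapping.keys c. Poly_Mapping.lookup c v * g v"
  assumes V: "vectorspace class_ring V"
    and g_add: "\<And>v w. v \<in> carrier V \<Longrightarrow> w \<in> carrier V \<Longrightarrow> g (v \<oplus>\<^bsub>V\<^esub> w) = g v + g w"
    and g_smult: "\<And>a v. v \<in> carrier V \<Longrightarrow> g (a \<odot>\<^bsub>V\<^esub> v) = h a * g v"
    and cd: "c - d \<in> tensor_kernel h V"
  shows "s c = s d"
proof -
  interpret V: vectorspace class_ring V by fact
  let ?M = "free_vs (carrier V) :: ('e, 'v \<Rightarrow>\<^sub>0 'e) module"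
  interpret M: vectorspace class_ring ?M by (rule vectorspace_free_vs)
  have s_sup: "s c = (\<Sum>v\<in>A. Poly_Mapping.lookup c v * g v)"
    if "finite A" "Poly_Mapping.keys c \<subseteq> A" for c A
    unfolding s_def using that by (intro sum.mono_neutral_left) (auto simp: in_keys_iff)
  have s_add: "s (c + d) = s c + s d" for c d
  proof -
    let ?A = "Poly_Mapping.keys c \<union> Poly_Mapping.keys d"
    have "s (c + d) = (\<Sum>v\<in>?A. Poly_Mapping.lookup (c + d) v * g v)"
      by (rule s_sup) (auto simp: in_keys_iff lookup_add)
    then show ?thesis
      using s_sup[of ?A c] s_sup[of ?A d] by (simp add: lookup_add distrib_right sum.distrib)
  qed
  have s_diff: "s (c - d) = s c - s d" for c d
    using s_add[of "c - d" d] by (simp add: algebra_simps)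
  have s_sm: "s (Poly_Mapping.map ((*) a) c) = a * s c" for a c
    using s_sup[OF _ keys_smult, of c a] by (simp add: lookup_smult s_def sum_distrib_left mult_ac)
  have s_single: "s (Poly_Mapping.single v e) = e * g v" for v e
    using s_sup[of "{v}" "Poly_Mapping.single v e"] by simp
  have "tensor_kernel h V \<subseteq> {c \<in> carrier ?M. s c = 0}"
    unfolding tensor_kernel_def
  proof (rule M.span_is_subset)
    have "s c = 0" if "c \<in> tensor_relations h V" for c
      using that by (auto simp: tensor_relations_def s_diff s_single g_add g_smult)
    then show "tensor_relations h V \<subseteq> {c \<in> carrier ?M. s c = 0}"
      using tensor_kernel_submodule(2)[OF V, of h] by auto
    have "s 0 = 0" by (simp add: s_def)
    then show "LinearCombinations.submodule class_ring {c \<in> carrier ?M. s c = 0} ?M"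
      using M.a_closed M.zero_closed M.smult_closed
      by (auto simp: LinearCombinations.submodule_def M.module_axioms)
         (auto simp: free_vs_simps s_add s_sm)
  qed
  then show ?thesis using cd s_diff[of c d] by auto
qed

text \<open>
  The tensors \<open>1 \<otimes> v\<close> generate the tensor product, and those \<open>v\<close> for which \<open>1 \<otimes> v\<close> lies in a given
  subspace form a subspace of \<open>F\<^sup>n\<close>; hence it suffices to test the unit vectors.
\<close>

lemma tensor_generated_by_unit_vecs:
  fixes h :: "'f::field \<Rightarrow> 'e::field" and n :: nat
  defines "M \<equiv> free_vs (carrier_vec n) :: ('e, 'f vec \<Rightarrow>\<^sub>0 'e) module"
  assumes h: "field_hom h" and Q: "LinearCombinations.submodule class_ring Q M"
    and rel: "tensor_relations h (module_vec TYPE('f) n) \<subseteq> Q"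
    and unit: "\<And>i. i < n \<Longrightarrow> Poly_Mapping.single (unit_vec n i) 1 \<in> Q"
  shows "carrier M \<subseteq> Q"
proof
  interpret h: field_hom h by fact
  interpret V: vec_space "TYPE('f)" n .
  note Q_rules = free_vs_submoduleD[OF Q[unfolded M_def]]
  have add_rel: "Poly_Mapping.single (v + w) 1 - Poly_Mapping.single v 1 - Poly_Mapping.single w 1 \<in> Q"
    if "v \<in> carrier_vec n" "w \<in> carrier_vec n" for v w :: "'f vec"
    using that by (intro rel[THEN subsetD]) (auto simp: tensor_relations_def module_vec_simps)
  have sm_rel: "Poly_Mapping.single (a \<cdot>\<^sub>v v) 1 - Poly_Mapping.single v (h a) \<in> Q"
    if "v \<in> carrier_vec n" for a and v :: "'f vec"
    using that by (intro rel[THEN subsetD]) (auto simp: tensor_relations_def module_vec_simps)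
  let ?U = "{v \<in> carrier_vec n. Poly_Mapping.single v 1 \<in> Q}"
  have U_add: "v + w \<in> ?U" if "v \<in> ?U" "w \<in> ?U" for v w
    using that Q_rules(2)[OF add_rel[of v w] Q_rules(2)[of "Poly_Mapping.single v 1" "Poly_Mapping.single w 1"]]
    by (auto simp: algebra_simps)
  have U_sm: "a \<cdot>\<^sub>v v \<in> ?U" if "v \<in> ?U" for a v
    using that Q_rules(2)[OF sm_rel[of v a] Q_rules(4)[of "Poly_Mapping.single v 1" "h a"]]
    by (auto simp: map_mult_single)
  have "0 \<cdot>\<^sub>v 0\<^sub>v n = (0\<^sub>v n :: 'f vec)" by auto
  then have U_zero: "0\<^sub>v n \<in> ?U" using sm_rel[of "0\<^sub>v n" 0] by simp
  have "LinearCombinations.submodule class_ring ?U (module_vec TYPE('f) n)"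
    using U_add U_sm U_zero V.module_axioms
    by (simp add: LinearCombinations.submodule_def module_vec_simps)
  moreover have "set (unit_vecs n) \<subseteq> ?U" using unit by (auto simp: unit_vecs_def)
  ultimately have "V.span (set (unit_vecs n)) \<subseteq> ?U" by (intro V.span_is_subset)
  then have single: "Poly_Mapping.single v 1 \<in> Q" if "v \<in> carrier_vec n" for v
    using that V.span_unit_vecs_is_carrier by auto
  fix c assume "c \<in> carrier M"
  then have c: "Poly_Mapping.keys c \<subseteq> carrier_vec n" by (simp add: M_def free_vs_simps)
  have "(\<Sum>v\<in>A. Poly_Mapping.single v (Poly_Mapping.lookup c v)) \<in> Q"
    if "finite A" "A \<subseteq> carrier_vec n" for A
    using that
  proof (induction A)
    case empty
    then show ?case using Q_rules(1) by auto
  next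
    case (insert v A)
    then show ?case
      using Q_rules(2)[OF Q_rules(4)[OF single[of v], of "Poly_Mapping.lookup c v"]]
      by (auto simp: map_mult_single)
  qed
  moreover have "c = (\<Sum>v\<in>Poly_Mapping.keys c. Poly_Mapping.single v (Poly_Mapping.lookup c v))"
    by (intro poly_mapping_eqI) (auto simp: lookup_sum lookup_single when_def in_keys_iff)
  ultimately show "c \<in> Q" using c by (metis (no_types, lifting) finite_keys)
qed

text \<open>
  The isometry sends \<open>x\<close> to \<open>\<Sum>\<^sub>i x\<^sub>i \<otimes> e\<^sub>i\<close>. It is injective because the coordinate functionals recover \<open>x\<close>,
  and surjective because its image is a subspace containing all \<open>1 \<otimes> e\<^sub>i\<close>.
\<close>

lemma isometric_extend_diag_form:
  fixes h :: "'f::field \<Rightarrow> 'e::field" and as :: "'f list"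
  assumes h: "field_hom h" and p: "0 < p" "CHAR('f) = p"
  shows "isometric (diag_form p (map h as)) (extend_form p h (diag_form p as))"
proof -
  interpret h: field_hom h by fact
  define n where "n = length as"
  define \<phi> where "\<phi> = diag_form p as"
  have sp: "space \<phi> = module_vec TYPE('f) n" by (simp add: \<phi>_def diag_form_def n_def)
  have \<phi>: "p_form p \<phi>" unfolding \<phi>_def using p by (rule p_form_diag_form)
  interpret V: vec_space "TYPE('f)" n .
  define M where "M = (free_vs (carrier_vec n) :: ('e, 'f vec \<Rightarrow>\<^sub>0 'e) module)"
  interpret M: vectorspace class_ring M unfolding M_def by (rule vectorspace_free_vs)
  define N where "N = tensor_kernel h (module_vec TYPE('f) n)"
  have cV: "carrier (module_vec TYPE('f) n) = carrier_vec n" by (simp add: module_vec_simps)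
  have N: "LinearCombinations.submodule class_ring N M"
    using tensor_kernel_submodule(1)[OF V.vectorspace_axioms, of h] by (simp add: N_def M_def cV)
  have rel: "tensor_relations h (module_vec TYPE('f) n) \<subseteq> N"
    unfolding N_def tensor_kernel_def
    using M.in_own_span[of "tensor_relations h (module_vec TYPE('f) n)"]
      tensor_kernel_submodule(2)[OF V.vectorspace_axioms, of h] by (simp add: M_def cV)
  note N_rules = free_vs_submoduleD[OF N[unfolded M_def]]
  note cosets = free_vs_cosets[OF N[unfolded M_def], folded M_def]
  define T where "T x = (\<Sum>i<n. Poly_Mapping.single (unit_vec n i :: 'f vec) (x $ i))" for x :: "'e vec"
  have inj_unit: "inj_on (unit_vec n :: nat \<Rightarrow> 'f vec) {..<n}"
    by (auto simp: inj_on_def)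
  have lookup_T: "Poly_Mapping.lookup (T x) (unit_vec n i) = x $ i" if "i < n" for x i
  proof -
    have "Poly_Mapping.lookup (T x) (unit_vec n i) = (\<Sum>j<n. if j = i then x $ j else 0)"
      unfolding T_def lookup_sum
      by (intro sum.cong) (auto simp: lookup_single when_def)
    then show ?thesis using that by simp
  qed
  have keys_T: "Poly_Mapping.keys (T x) \<subseteq> unit_vec n ` {..<n}" for x
  proof -
    have "Poly_Mapping.lookup (T x) v = 0" if "v \<notin> unit_vec n ` {..<n}" for v
      unfolding T_def lookup_sum using that
      by (intro sum.neutral) (auto simp: lookup_single when_def)
    then show ?thesis by (auto simp: in_keys_iff)
  qed
  have T_carrier: "T x \<in> carrier M" for x
    using keys_T[of x] by (auto simp: M_def free_vs_simps)
  have sum_T: "(\<Sum>v\<in>Poly_Mapping.keys (T x). g (Poly_Mapping.lookup (T x) v) v) = (\<Sum>i<n. g (x $ i) (unit_vec n i))"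
    if "\<And>v. g 0 v = 0" for g :: "'e \<Rightarrow> 'f vec \<Rightarrow> 'e" and x
  proof -
    have "(\<Sum>v\<in>Poly_Mapping.keys (T x). g (Poly_Mapping.lookup (T x) v) v) =
        (\<Sum>v\<in>unit_vec n ` {..<n}. g (Poly_Mapping.lookup (T x) v) v)"
      using keys_T that by (intro sum.mono_neutral_left) (auto simp: in_keys_iff)
    also have "\<dots> = (\<Sum>i<n. g (x $ i) (unit_vec n i))"
      by (simp add: sum.reindex[OF inj_unit] lookup_T)
    finally show ?thesis .
  qed
  have T_add: "T (x + y) = T x + T y" if "x \<in> carrier_vec n" "y \<in> carrier_vec n" for x y
    using that by (simp add: T_def single_add sum.distrib)
  have T_sm: "T (a \<cdot>\<^sub>v x) = Poly_Mapping.map ((*) a) (T x)" if "x \<in> carrier_vec n" for a x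
    using that by (intro poly_mapping_eqI)
      (auto simp: T_def lookup_smult lookup_sum lookup_single when_def sum_distrib_left intro!: sum.cong)
  have inj: "x = y" if "x \<in> carrier_vec n" "y \<in> carrier_vec n" "T x - T y \<in> N" for x y
  proof (rule eq_vecI)
    show "dim_vec x = dim_vec y" using that by simp
    fix i assume "i < dim_vec y"
    then have i: "i < n" using that by simp
    have coord: "(\<Sum>v\<in>Poly_Mapping.keys (T z). Poly_Mapping.lookup (T z) v * h (v $ i)) = z $ i" for z
    proof -
      have "(\<Sum>v\<in>Poly_Mapping.keys (T z). Poly_Mapping.lookup (T z) v * h (v $ i)) =
          (\<Sum>j<n. z $ j * h (unit_vec n j $ i))"
        by (rule sum_T) simp
      also have "\<dots> = (\<Sum>j<n. if j = i then z $ j else 0)"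
        using i by (intro sum.cong) auto
      finally show ?thesis using i by simp
    qed
    show "x $ i = y $ i"
      using tensor_kernel_functional[OF V.vectorspace_axioms, of "\<lambda>v. h (v $ i)" h "T x" "T y"] i that(3)
      by (simp add: coord N_def module_vec_simps h.hom_add h.hom_mult)
  qed
  \<comment> \<open>\<open>Q\<close> is the preimage in the free space of the image of the map \<open>x \<mapsto> \<Sum>\<^sub>i x\<^sub>i \<otimes> e\<^sub>i\<close>.\<close>
  define Q where "Q = {c \<in> carrier M. \<exists>x\<in>carrier_vec n. c - T x \<in> N}"
  have T_0: "T (0\<^sub>v n) = 0" by (simp add: T_def)
  have N_Q: "N \<subseteq> Q"
    using LinearCombinations.submodule.subset[OF N] by (auto simp: Q_def T_0 intro!: bexI[of _ "0\<^sub>v n"])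
  have Q_add: "c + d \<in> Q" if "c \<in> Q" "d \<in> Q" for c d
  proof -
    obtain x y where "x \<in> carrier_vec n" "c - T x \<in> N" "y \<in> carrier_vec n" "d - T y \<in> N"
      using \<open>c \<in> Q\<close> \<open>d \<in> Q\<close> by (auto simp: Q_def)
    then have "c + d - T (x + y) \<in> N" "x + y \<in> carrier_vec n"
      using N_rules(2)[of "c - T x" "d - T y"] by (auto simp: T_add algebra_simps)
    then show ?thesis using that M.a_closed[of c d] by (auto simp: Q_def M_def free_vs_simps(2))
  qed
  have Q_sm: "Poly_Mapping.map ((*) a) c \<in> Q" if "c \<in> Q" for a c
  proof -
    obtain x where "x \<in> carrier_vec n" "c - T x \<in> N"
      using \<open>c \<in> Q\<close> by (auto simp: Q_def)
    then have "Poly_Mapping.map ((*) a) c - T (a \<cdot>\<^sub>v x) \<in> N" "a \<cdot>\<^sub>v x \<in> carrier_vec n"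
      using N_rules(4)[of "c - T x" a] by (auto simp: T_sm map_mult_diff)
    then show ?thesis using that M.smult_closed[of a c] by (auto simp: Q_def M_def free_vs_simps(4))
  qed
  have Q: "carrier M \<subseteq> Q"
    unfolding M_def
  proof (rule tensor_generated_by_unit_vecs[OF h])
    show "LinearCombinations.submodule class_ring Q (free_vs (carrier_vec n))"
      using Q_add Q_sm N_Q N_rules(1) M.module_axioms
      by (auto simp: LinearCombinations.submodule_def M_def free_vs_simps(2-4)) (auto simp: Q_def M_def)
    show "tensor_relations h (module_vec TYPE('f) n) \<subseteq> Q" using rel N_Q by auto
    show "Poly_Mapping.single (unit_vec n i) 1 \<in> Q" if "i < n" for i
    proof -
      have "T (unit_vec n i) = (\<Sum>j<n. if j = i then Poly_Mapping.single (unit_vec n i) 1 else 0)"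
        unfolding T_def using that by (intro sum.cong) auto
      then have "Poly_Mapping.single (unit_vec n i) 1 = T (unit_vec n i)" using that by simp
      moreover have "T (unit_vec n i) \<in> Q"
        unfolding Q_def using N_rules(1) T_carrier by (auto intro!: bexI[of _ "unit_vec n i"])
      ultimately show ?thesis by simp
    qed
  qed
  have space_ext: "space (extend_form p h \<phi>) = quot_module M N"
    by (simp add: extend_form_def tensor_vs_def sp N_def M_def cV)
  have space_diag: "space (diag_form p (map h as)) = module_vec TYPE('e) n"
    by (simp add: diag_form_def n_def)
  have "isometric (diag_form p (map h as)) (extend_form p h \<phi>)"
    unfolding isometric_def space_ext space_diag
  proof (intro bexI[of _ "\<lambda>x. N +>\<^bsub>M\<^esub> T x"] conjI ballI)
    show "(\<lambda>x. N +>\<^bsub>M\<^esub> T x) \<in>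
        LinearCombinations.module_hom class_ring (module_vec TYPE('e) n) (quot_module M N)"
      using T_carrier
      by (auto simp: LinearCombinations.module_hom_def module_vec_simps cosets T_add T_sm)
         (auto simp: quot_module_simps)
    have "inj_on (\<lambda>x. N +>\<^bsub>M\<^esub> T x) (carrier_vec n)"
      using inj by (auto simp: inj_on_def cosets)
    moreover have "(\<lambda>x. N +>\<^bsub>M\<^esub> T x) ` carrier_vec n = (\<lambda>c. N +>\<^bsub>M\<^esub> c) ` carrier M"
    proof
      show "(\<lambda>x. N +>\<^bsub>M\<^esub> T x) ` carrier_vec n \<subseteq> (\<lambda>c. N +>\<^bsub>M\<^esub> c) ` carrier M"
        using T_carrier by blast
      show "(\<lambda>c. N +>\<^bsub>M\<^esub> c) ` carrier M \<subseteq> (\<lambda>x. N +>\<^bsub>M\<^esub> T x) ` carrier_vec n"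
      proof clarify
        fix c assume "c \<in> carrier M"
        then obtain x where "x \<in> carrier_vec n" "c - T x \<in> N" using Q by (auto simp: Q_def)
        then show "N +>\<^bsub>M\<^esub> c \<in> (\<lambda>x. N +>\<^bsub>M\<^esub> T x) ` carrier_vec n"
          by (intro image_eqI[of _ _ x]) (simp_all add: cosets(1))
      qed
    qed
    ultimately show "bij_betw (\<lambda>x. N +>\<^bsub>M\<^esub> T x) (carrier (module_vec TYPE('e) n)) (carrier (quot_module M N))"
      by (simp add: bij_betw_def quot_module_simps module_vec_simps)
  next
    fix x :: "'e vec"
    assume "x \<in> carrier (module_vec TYPE('e) n)"
    have val_unit: "val \<phi> (unit_vec n i) = as ! i" if "i < n" for i
    proof -
      have "val \<phi> (unit_vec n i) = (\<Sum>j<n. as ! j * (unit_vec n i $ j) ^ p)"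
        by (simp add: \<phi>_def diag_form_def n_def)
      also have "\<dots> = (\<Sum>j<n. if j = i then as ! j else 0)"
        using that p by (intro sum.cong) auto
      finally show ?thesis using that by simp
    qed
    have "val (extend_form p h \<phi>) (N +>\<^bsub>M\<^esub> T x) =
        (\<Sum>v\<in>Poly_Mapping.keys (T x). Poly_Mapping.lookup (T x) v ^ p * h (val \<phi> v))"
      using val_extend_form[OF \<phi> h, of "T x"] T_carrier by (simp add: sp cV M_def N_def)
    also have "\<dots> = (\<Sum>i<n. (x $ i) ^ p * h (val \<phi> (unit_vec n i)))"
      using p by (intro sum_T) simp
    also have "\<dots> = val (diag_form p (map h as)) x"
      by (simp add: diag_form_def val_unit mult.commute flip: n_def)
    finally show "val (diag_form p (map h as)) x = val (extend_form p h \<phi>) (N +>\<^bsub>M\<^esub> T x)" ..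
  qed
  then show ?thesis by (simp add: \<phi>_def)
qed

section \<open>Binary forms with first coefficient one\<close>

lemma CHAR_field_hom:
  fixes h :: "'f::field \<Rightarrow> 'e::field"
  assumes "field_hom h"
  shows "CHAR('e) = CHAR('f)"
proof -
  interpret h: field_hom h by fact
  show ?thesis
  proof (rule CHAR_eqI)
    show "of_nat CHAR('f) = (0::'e)"
      using h.hom_of_nat[of "CHAR('f)"] by simp
    show "CHAR('f) dvd n" if "of_nat n = (0::'e)" for n
      using that h.hom_of_nat[of n] by (metis h.hom_0_iff of_nat_eq_0_iff_char_dvd)
  qed
qed

lemma val_diag_form_binary: "val (diag_form p [b, c]) x = b * (x $ 0) ^ p + c * (x $ 1) ^ p"
  by (simp add: diag_form_def eval_nat_numeral)

text \<open>An isotropic vector with \<open>x\<^sub>1 \<noteq> 0\<close> would give \<open>b = (- x\<^sub>0 / x\<^sub>1)\<^sup>p\<close>.\<close>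

lemma anisotropic_binary:
  fixes b :: "'f::field"
  assumes p: "prime p" "CHAR('f) = p" and b: "b \<notin> range (\<lambda>x. x ^ p)"
  shows "anisotropic (diag_form p [1, b])"
  unfolding anisotropic_def
proof (intro ballI impI)
  interpret frob: field_hom "\<lambda>x::'f. x ^ p" using p by (rule field_hom_frobenius)
  fix x assume x: "x \<in> carrier (space (diag_form p [1, b]))" "val (diag_form p [1, b]) x = 0"
  then have eq: "(x $ 0) ^ p = - (b * (x $ 1) ^ p)"
    by (simp add: val_diag_form_binary eq_neg_iff_add_eq_0)
  have x1: "x $ 1 = 0"
  proof (rule ccontr)
    assume "x $ 1 \<noteq> 0"
    then have "b = - ((x $ 0) ^ p) / (x $ 1) ^ p" using eq by simp
    also have "\<dots> = (- (x $ 0) / x $ 1) ^ p" using frob.hom_uminus[of "x $ 0 / x $ 1"] by (simp add: power_divide)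
    finally show False using b by blast
  qed
  then have "x $ 0 = 0" using eq p by (simp add: prime_gt_0_nat)
  with x1 x show "x = \<zero>\<^bsub>space (diag_form p [1, b])\<^esub>"
    by (auto simp: diag_form_def module_vec_simps less_Suc_eq numeral_2_eq_2)
qed

text \<open>The identity behind this is \<open>x\<^sup>p + c\<^sup>p y\<^sup>p = (x + c y)\<^sup>p\<close>.\<close>

lemma isometric_binary_pth_power:
  fixes c :: "'f::field"
  assumes p: "prime p" "CHAR('f) = p"
  shows "isometric (diag_form p [1, c ^ p]) (diag_form p [1, 0])"
proof -
  interpret frob: field_hom "\<lambda>x::'f. x ^ p" using p by (rule field_hom_frobenius)
  define f where "f e x = vec 2 (\<lambda>i. if i = 0 then x $ 0 + e * x $ 1 else x $ 1)" for e and x :: "'f vec"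
  have sp: "space (diag_form p [1, b]) = module_vec TYPE('f) 2" for b
    by (simp add: diag_form_def numeral_2_eq_2)
  have less_2: "i < 2 \<longleftrightarrow> i = 0 \<or> i = 1" for i :: nat by auto
  have inverse: "f (- e) (f e x) = x" if "x \<in> carrier_vec 2" for e x
    using that by (intro eq_vecI) (auto simp: f_def less_2)
  show ?thesis
    unfolding isometric_def sp
  proof (intro bexI[of _ "f c"] conjI ballI)
    show "f c \<in> LinearCombinations.module_hom class_ring (module_vec TYPE('f) 2) (module_vec TYPE('f) 2)"
      by (auto simp: LinearCombinations.module_hom_def module_vec_simps f_def less_2 algebra_simps)
    have "bij_betw (f c) (carrier_vec 2) (carrier_vec 2)"
      using inverse[of _ c] inverse[of _ "- c"]
      by (intro bij_betw_byWitness[where f' = "f (- c)"]) (auto simp: f_def)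
    then show "bij_betw (f c) (carrier (module_vec TYPE('f) 2)) (carrier (module_vec TYPE('f) 2))"
      by (simp add: module_vec_simps)
    show "val (diag_form p [1, c ^ p]) x = val (diag_form p [1, 0]) (f c x)" for x
      by (simp add: val_diag_form_binary f_def frob.hom_add power_mult_distrib)
  qed
qed

lemma defect_extend_binary_not_pth_power:
  fixes h :: "'f::field \<Rightarrow> 'e::field"
  assumes h: "field_hom h" and p: "prime p" "CHAR('f) = p"
    and b: "h b \<notin> range (\<lambda>x. x ^ p)"
  shows "defect p (extend_form p h (diag_form p [1, b])) = 0"
proof -
  interpret h: field_hom h by fact
  have p0: "0 < p" using p by (simp add: prime_gt_0_nat)
  have char: "CHAR('e) = p" using CHAR_field_hom[OF h] p by simp
  let ?E = "extend_form p h (diag_form p [1, b])"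
  have iso: "isometric (diag_form p [1, h b]) ?E"
    using isometric_extend_diag_form[OF h p0 p(2), of "[1, b]"] by simp
  have E: "vectorspace class_ring (space ?E)"
    using p_form_diag_form[OF p0 p(2), of "[1, b]"]
    by (simp add: extend_form_def vectorspace_tensor_vs p_form_def)
  have D: "p_form p (diag_form p [1, h b])" using p0 char by (rule p_form_diag_form)
  have "vectorspace class_ring (space (diag_form p [1, h b]))"
    using D by (simp add: p_form_def)
  then have "anisotropic ?E"
    using E iso anisotropic_binary[OF p(1) char b] by (rule anisotropic_isometric)
  with p_form_isometric[OF D E iso] show ?thesis by (rule defect_anisotropic)
qed

lemma defect_extend_binary_pth_power:
  fixes h :: "'f::field \<Rightarrow> 'e::field"
  assumes h: "field_hom h" and p: "prime p" "CHAR('f) = p"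
    and b: "h b \<in> range (\<lambda>x. x ^ p)" and b': "h b' \<in> range (\<lambda>x. x ^ p)"
  shows "defect p (extend_form p h (diag_form p [1, b])) = defect p (extend_form p h (diag_form p [1, b']))"
proof -
  interpret h: field_hom h by fact
  have p0: "0 < p" using p by (simp add: prime_gt_0_nat)
  have char: "CHAR('e) = p" using CHAR_field_hom[OF h] p by simp
  let ?E = "\<lambda>b. extend_form p h (diag_form p [1, b])"
  have E: "vectorspace class_ring (space (?E b))" for b
    using p_form_diag_form[OF p0 p(2), of "[1, b]"]
    by (simp add: extend_form_def vectorspace_tensor_vs p_form_def)
  have D: "vectorspace class_ring (space (diag_form p [1, c :: 'e]))" for c
    using p_form_diag_form[OF p0 char, of "[1, c]"] by (simp add: p_form_def)
  have iso: "isometric (diag_form p [1, 0]) (?E b)" if "h b \<in> range (\<lambda>x. x ^ p)" for b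
  proof -
    from that obtain c where c: "h b = c ^ p" by auto
    have "isometric (diag_form p [1, 0]) (diag_form p [1, h b])"
      unfolding c using D isometric_binary_pth_power[OF p(1) char] by (rule isometric_sym)
    moreover have "isometric (diag_form p [1, h b]) (?E b)"
      using isometric_extend_diag_form[OF h p0 p(2), of "[1, b]"] by simp
    ultimately show ?thesis by (rule isometric_trans)
  qed
  have "isometric (?E b) (?E b')"
    using isometric_sym[OF D iso[OF b]] iso[OF b'] by (rule isometric_trans)
  then show ?thesis by (intro defect_isometric E)
qed

section \<open>Comparison of the two forms\<close>

lemma vishik_equivalent_binary_square:
  fixes a :: "'f::field"
  assumes p: "prime p" "p > 2" "CHAR('f) = p"
  shows "vishik_equivalent TYPE('e::field) p (diag_form p [1, a]) (diag_form p [1, a\<^sup>2])"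
  unfolding vishik_equivalent_def
proof (intro conjI allI impI)
  show "form_dim (diag_form p [1, a]) = form_dim (diag_form p [1, a\<^sup>2])"
    by (simp add: form_dim_def diag_form_def)
  fix h :: "'f \<Rightarrow> 'e" assume h: "field_hom h"
  then interpret h: field_hom h .
  have "coprime 2 p" using p by (simp add: prime_odd_nat)
  have pth_power_iff: "h (a\<^sup>2) \<in> range (\<lambda>x. x ^ p) \<longleftrightarrow> h a \<in> range (\<lambda>x. x ^ p)"
  proof
    assume "h (a\<^sup>2) \<in> range (\<lambda>x. x ^ p)"
    then obtain x where "h a ^ 2 = x ^ p" by (auto simp: h.hom_power)
    then obtain y where "h a = y ^ p"
      using pth_power_if_coprime_power[of 2 p "h a" x] \<open>coprime 2 p\<close> p by auto
    then show "h a \<in> range (\<lambda>x. x ^ p)" by simp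
  next
    assume "h a \<in> range (\<lambda>x. x ^ p)"
    then obtain c where "h a = c ^ p" by auto
    then have "h (a\<^sup>2) = (c\<^sup>2) ^ p" by (simp add: power2_eq_square power_mult_distrib h.hom_mult)
    then show "h (a\<^sup>2) \<in> range (\<lambda>x. x ^ p)" by simp
  qed
  show "defect p (extend_form p h (diag_form p [1, a])) = defect p (extend_form p h (diag_form p [1, a\<^sup>2]))"
  proof (cases "h a \<in> range (\<lambda>x. x ^ p)")
    case True
    then have "h (a\<^sup>2) \<in> range (\<lambda>x. x ^ p)" by (rule pth_power_iff[THEN iffD2])
    with True show ?thesis by (rule defect_extend_binary_pth_power[OF h p(1,3)])
  next
    case False
    then have "h (a\<^sup>2) \<notin> range (\<lambda>x. x ^ p)" by (simp only: pth_power_iff not_False_eq_True)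
    then have "defect p (extend_form p h (diag_form p [1, a\<^sup>2])) = 0"
      by (rule defect_extend_binary_not_pth_power[OF h p(1,3)])
    moreover have "defect p (extend_form p h (diag_form p [1, a])) = 0"
      using False by (rule defect_extend_binary_not_pth_power[OF h p(1,3)])
    ultimately show ?thesis by simp
  qed
qed

lemma not_similar_binary_square:
  fixes a :: "'f::field"
  assumes p: "prime p" "p > 3" "CHAR('f) = p" and a: "a \<notin> range (\<lambda>x. x ^ p)"
  shows "\<not> similar (diag_form p [1, a]) (diag_form p [1, a\<^sup>2])"
proof
  interpret frob: field_hom "\<lambda>x::'f. x ^ p" using p(1,3) by (rule field_hom_frobenius)
  let ?\<psi> = "diag_form p [1, a\<^sup>2]"
  assume "similar (diag_form p [1, a]) ?\<psi>"
  then obtain c f where c: "c \<noteq> 0"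
    and "\<forall>v\<in>carrier (space (diag_form p [1, a])). val (diag_form p [1, a]) v = val (scale_form c ?\<psi>) (f v)"
    unfolding similar_def isometric_def by blast
  then have f: "val (diag_form p [1, a]) v = c * val ?\<psi> (f v)" if "v \<in> carrier_vec 2" for v
    using that by (simp add: scale_form_def diag_form_def module_vec_simps numeral_2_eq_2)
  \<comment> \<open>The unit vectors have the values \<open>1\<close> and \<open>a\<close> under \<open>\<langle>1, a\<rangle>\<close>, so the values at their images have
    ratio \<open>a\<close>.\<close>
  define w w' where "w = f (unit_vec 2 0)" and "w' = f (unit_vec 2 1)"
  have one: "1 = c * val ?\<psi> w" and "a = c * val ?\<psi> w'"
    using f[of "unit_vec 2 0"] f[of "unit_vec 2 1"] p
    by (simp_all add: w_def w'_def val_diag_form_binary)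
  then have "c * (a * val ?\<psi> w) = c * val ?\<psi> w'" by (simp add: mult.left_commute flip: one)
  then have ratio: "a * val ?\<psi> w = val ?\<psi> w'" using c by simp
  \<comment> \<open>Written out, the ratio is a cubic relation for \<open>a\<close>; these are the \<open>p\<close>-th roots of its coefficients.\<close>
  define P where "P = [:- (w' $ 0), w $ 0, - (w' $ 1), w $ 1:]"
  have "poly (map_poly (\<lambda>x. x ^ p) P) a = a * val ?\<psi> w - val ?\<psi> w'"
    by (simp add: P_def frob.map_poly_pCons_hom frob.hom_uminus val_diag_form_binary)
       (simp add: algebra_simps power2_eq_square)
  then have "poly (map_poly (\<lambda>x. x ^ p) P) a = 0" using ratio by simp
  moreover have "degree P < p" using p(2) by (simp add: P_def)
  ultimately have "P = 0" using poly_frobenius_nonzero[OF p(1,3) a] by blast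
  then have "w $ 0 = 0" "w $ 1 = 0" by (simp_all add: P_def)
  then have "val ?\<psi> w = 0" using p(1) by (simp add: val_diag_form_binary prime_gt_0_nat)
  then show False using one by simp
qed

theorem mainTheorem5:
  fixes p :: nat and a :: "'f::field"
  assumes "prime p" and "p > 3" and "CHAR('f) = p"
    and "a \<notin> range (\<lambda>x::'f. x ^ p)"
  shows "vishik_equivalent TYPE('e::field) p (diag_form p [1, a]) (diag_form p [1, a\<^sup>2])
    \<and> \<not> similar (diag_form p [1, a]) (diag_form p [1, a\<^sup>2])"
proof
  show "vishik_equivalent TYPE('e) p (diag_form p [1, a]) (diag_form p [1, a\<^sup>2])"
    by (rule vishik_equivalent_binary_square) (use assms in simp_all)
  show "\<not> similar (diag_form p [1, a]) (diag_form p [1, a\<^sup>2])"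
    using assms by (rule not_similar_binary_square)
qed

end
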